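(* Let $X$ and $Y$ be Banach spaces that are sphere equivalent, $X\sim_S Y$. Then for every $p\in[1,\infty)$ and every sequence $\{G_n\}_{n\in\mathbb{N}}$ of finite connected graphs, $\{G_n\}_n$ is a family of $(X,p)$-anders if and only if it is a family of $(Y,p)$-anders.
   Context: Graphs $G=(V,E)$ are finite, connected, undirected, possibly with multiple edges and self-loops, with at least two vertices; $E$ is the set of oriented edges. The degree of $v$ is the number of oriented edges $e=(v,w)\in E$ starting at $v$; $\Delta(G)$ is the maximal degree; $G$ carries the path metric, and $\mathrm{diam}(G)$ is its diameter. Banach spaces are nonzero. For a Banach space $X$ and $p\in[1,\infty)$, the $(X,p)$-spectral gap is $$\lambda_1(G;X,p):=\frac12\inf_{f}\frac{\sum_{v\in V}\sum_{e=(v,w)\in E}\|f(w)-f(v)\|^p}{\sum_{v\in V}\|f(v)-m(f)\|^p},\qquad m(f):=\frac1{|V|}\sum_{v\in V}f(v),$$ where $f$ runs over all nonconstant maps $f\colon V\to X$. A sequence $\{G_n\}_n$ of finite connected graphs is a family of $(X,p)$-anders if $\sup_n\Delta(G_n)<\infty$, $\lim_{n\to\infty}\mathrm{diam}(G_n)=\infty$, and $\inf_n\lambda_1(G_n;X,p)>0$. $S(X)$ denotes the unit sphere of $X$. Two Banach spaces $X,Y$ are sphere equivalent, $X\sim_S Y$, if there is a uniform homeomorphism $S(X)\to S(Y)$ (a bijection uniformly continuous in both directions). *)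

theory Defs
  imports "HOL-Analysis.Analysis" "Graph_Theory.Shortest_Path" "Graph_Theory.Digraph_Component"
begin

(* An undirected multigraph is given by its oriented edges (the arcs): the involution r reverses
   the orientation of an edge.  A self-loop may be fixed by r or be paired with a second arc at
   the same vertex, so loops may contribute one or two oriented edges to the degree. *)
locale finite_connected_graph = fin_digraph G for G :: "('v, 'e) pre_digraph" +
  assumes ex_reversal:
      "\<exists>r. \<forall>e \<in> arcs G. r e \<in> arcs G \<and> r (r e) = e
             \<and> tail G (r e) = head G e \<and> head G (r e) = tail G e"
    and connected_graph: "Digraph_Component.connected G"
    and two_vertices: "2 \<le> card (verts G)"

definition max_degree :: "('v, 'e) pre_digraph \<Rightarrow> nat" where
  "max_degree G = Max (out_degree G ` verts G)"

definition graph_diam :: "('v, 'e) pre_digraph \<Rightarrow> ereal" where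
  "graph_diam G = (SUP u\<in>verts G. SUP v\<in>verts G. wf_digraph.\<mu> G (\<lambda>_. 1) u v)"

definition vertex_mean :: "('v, 'e) pre_digraph \<Rightarrow> ('v \<Rightarrow> 'a::real_vector) \<Rightarrow> 'a" where
  "vertex_mean G f = (1 / real (card (verts G))) *\<^sub>R (\<Sum>v\<in>verts G. f v)"

(* The real infimum is meaningful when the graph has at least two vertices and 'a is nonzero:
   then nonconstant maps exist, and all the quotients are nonnegative. *)
definition spectral_gap ::
  "('v, 'e) pre_digraph \<Rightarrow> 'a::banach itself \<Rightarrow> real \<Rightarrow> real" where
  "spectral_gap G X p = 1 / 2 *
     (INF f \<in> {f :: 'v \<Rightarrow> 'a. \<not> f constant_on verts G}.
        (\<Sum>v\<in>verts G. \<Sum>e\<in>out_arcs G v. norm (f (head G e) - f v) powr p)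
        / (\<Sum>v\<in>verts G. norm (f v - vertex_mean G f) powr p))"

definition anders_family ::
  "(nat \<Rightarrow> ('v, 'e) pre_digraph) \<Rightarrow> 'a::banach itself \<Rightarrow> real \<Rightarrow> bool" where
  "anders_family G X p \<longleftrightarrow>
     (\<forall>n. finite_connected_graph (G n)) \<and>
     bdd_above (range (\<lambda>n. max_degree (G n))) \<and>
     (\<lambda>n. graph_diam (G n)) \<longlonglongrightarrow> \<infinity> \<and>
     (INF n. spectral_gap (G n) X p) > 0"

definition sphere_equivalent :: "'a::banach itself \<Rightarrow> 'b::banach itself \<Rightarrow> bool" where
  "sphere_equivalent X Y \<longleftrightarrow>
     (\<exists>\<phi> :: 'a \<Rightarrow> 'b.
        bij_betw \<phi> (sphere 0 1) (sphere 0 1) \<and>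
        uniformly_continuous_on (sphere 0 1) \<phi> \<and>
        uniformly_continuous_on (sphere 0 1) (inv_into (sphere 0 1) \<phi>))"

end

theory Submission
  imports Defs
begin

text \<open>
A uniformly continuous map \<open>\<phi>\<close> between unit spheres extends radially to a norm-preserving map
\<open>\<Phi> x = \<parallel>x\<parallel> \<phi> (x / \<parallel>x\<parallel>)\<close> between the whole spaces. In general \<open>\<Phi>\<close> is neither Lipschitz nor
uniformly continuous, but homogeneity turns the uniform continuity of \<open>\<phi>\<close> into a pointwise estimate that
survives summation (\<open>radial_extension_powr_estimate\<close>): for every \<open>\<epsilon> > 0\<close> there is \<open>C\<close> with
\<open>\<parallel>\<Phi> a - \<Phi> b\<parallel>\<^sup>p \<le> \<epsilon> (\<parallel>a\<parallel>\<^sup>p + \<parallel>b\<parallel>\<^sup>p) + C \<parallel>a - b\<parallel>\<^sup>p\<close>. The constant \<open>C\<close> depends on \<open>\<epsilon>\<close>, \<open>p\<close> and \<open>\<phi>\<close>,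
and the estimate can be applied along all edges, or at all vertices, of any graph with the same \<open>C\<close>.

A positive lower bound \<open>c\<close> on the spectral gap is a Poincare inequality: \<open>2 c\<close> times the deviation of
a function from its mean is at most its Dirichlet energy. Suppose that this holds on a graph of degree
at most \<open>\<Delta>\<close> for functions with values in \<open>X\<close>, let \<open>\<Phi> : X \<rightarrow> Y\<close> and \<open>\<Psi> : Y \<rightarrow> X\<close> be mutually inverse
radial extensions, and let \<open>h\<close> be a function with values in \<open>Y\<close> and mean zero. Put
\<open>S = \<Sum>\<^sub>v \<parallel>h v\<parallel>\<^sup>p\<close> and \<open>g = \<Psi> \<circ> h\<close>, so that \<open>h = \<Phi> \<circ> g\<close>.
The estimate for \<open>\<Psi>\<close>, summed over the edges, bounds the energy of \<open>g\<close> by \<open>2 \<epsilon> \<Delta> S\<close> plus a multiple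
of the energy of \<open>h\<close>. The Poincare inequality then bounds the deviation of \<open>g\<close> from its mean \<open>m\<close>.
The estimate for \<open>\<Phi>\<close>, summed over the vertices, carries this over to a bound on the distance from \<open>h\<close>
to the constant \<open>\<Phi> m\<close>. Finally a function of mean zero cannot be much closer to a constant than to
zero (\<open>sum_norm_powr_le_distance_from_const\<close>, a consequence of Jensen's inequality), so that \<open>S\<close>
is bounded by a multiple of the energy of \<open>h\<close> plus small multiples of \<open>S\<close>, which are absorbed
(\<open>poincare_transfer_fixed_constants\<close>).

The resulting constant depends only on \<open>c\<close>, \<open>\<Delta>\<close>, \<open>p\<close> and the two sphere maps, and hence serves all
graphs of the sequence at once. Exchanging the roles of \<open>X\<close> and \<open>Y\<close> gives the converse.
\<close>

section \<open>Powers of norms\<close>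

text \<open>Convexity of the powers is stated on the open half-line in \<open>powr_convex\<close>; Jensen's inequality for
vectors that may vanish requires the endpoint 0, where convexity amounts to \<open>u\<^sup>p \<le> u\<close> for
\<open>0 \<le> u \<le> 1\<close>.\<close>

lemma convex_on_norm_powr:
  assumes "1 \<le> p"
  shows "convex_on UNIV (\<lambda>x :: 'a::real_normed_vector. norm x powr p)"
proof (rule convex_onI)
  have nonneg_powr: "((1 - t) * r + t * s) powr p \<le> (1 - t) * r powr p + t * s powr p"
    if trs: "0 < t" "t < 1" "0 \<le> r" "0 \<le> s" for t r s :: real
  proof -
    have shrink: "(u * r) powr p \<le> u * r powr p" if "0 \<le> u" "u \<le> 1" for u r :: real
    proof -
      have "u powr p \<le> u powr 1"
        using that assms powr_mono'[of 1 p u] by simp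
      then show ?thesis
        using that by (simp add: powr_mult mult_right_mono)
    qed
    consider "r = 0" | "s = 0" | "0 < r" "0 < s"
      using trs by linarith
    then show ?thesis
    proof cases
      case 1
      then show ?thesis using shrink[of t s] trs by simp
    next
      case 2
      then show ?thesis using shrink[of "1 - t" r] trs by simp
    next
      case 3
      then show ?thesis
        using convex_onD[OF powr_convex[OF assms], of t r s] trs by simp
    qed
  qed
  fix t :: real and x y :: 'a
  assume t: "0 < t" "t < 1"
  have "norm ((1 - t) *\<^sub>R x + t *\<^sub>R y) \<le> (1 - t) * norm x + t * norm y"
    using norm_triangle_ineq[of "(1 - t) *\<^sub>R x" "t *\<^sub>R y"] t by simp
  then have "norm ((1 - t) *\<^sub>R x + t *\<^sub>R y) powr p \<le> ((1 - t) * norm x + t * norm y) powr p"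
    using assms by (intro powr_mono2) auto
  also have "\<dots> \<le> (1 - t) * norm x powr p + t * norm y powr p"
    using t by (intro nonneg_powr) auto
  finally show "norm ((1 - t) *\<^sub>R x + t *\<^sub>R y) powr p \<le> (1 - t) * norm x powr p + t * norm y powr p" .
qed simp

lemma norm_add_powr_le:
  fixes x y :: "'a::real_normed_vector"
  assumes "0 \<le> p"
  shows "norm (x + y) powr p \<le> 2 powr p * (norm x powr p + norm y powr p)"
proof -
  have "norm (x + y) powr p \<le> (2 * max (norm x) (norm y)) powr p"
    using assms norm_triangle_ineq[of x y] by (intro powr_mono2) auto
  also have "\<dots> \<le> 2 powr p * (norm x powr p + norm y powr p)"
    by (auto simp: powr_mult max_def)
  finally show ?thesis .
qed

section \<open>Radial extension of maps between spheres\<close>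

definition radial_extension ::
  "('a::real_normed_vector \<Rightarrow> 'b::real_normed_vector) \<Rightarrow> 'a \<Rightarrow> 'b" where
  "radial_extension \<phi> x = norm x *\<^sub>R \<phi> (sgn x)"

lemma sgn_in_sphere: "x \<noteq> 0 \<Longrightarrow> sgn x \<in> sphere 0 1"
  for x :: "'a::real_normed_vector"
  by (simp add: norm_sgn)

lemma norm_radial_extension:
  assumes "\<phi> \<in> sphere 0 1 \<rightarrow> sphere 0 1"
  shows "norm (radial_extension \<phi> x) = norm x"
proof (cases "x = 0")
  case False
  then have "\<phi> (sgn x) \<in> sphere 0 1"
    using assms sgn_in_sphere by blast
  then show ?thesis by (simp add: radial_extension_def)
qed (simp add: radial_extension_def)

lemma radial_extension_inverse:
  assumes "\<psi> \<in> sphere 0 1 \<rightarrow> sphere 0 1" "\<And>y. y \<in> sphere 0 1 \<Longrightarrow> \<phi> (\<psi> y) = y"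
  shows "radial_extension \<phi> (radial_extension \<psi> y) = y"
proof (cases "y = 0")
  case False
  then have "\<psi> (sgn y) \<in> sphere 0 1"
    using assms(1) sgn_in_sphere by blast
  then have "sgn (radial_extension \<psi> y) = \<psi> (sgn y)"
    using False by (simp add: radial_extension_def sgn_div_norm)
  then have "radial_extension \<phi> (radial_extension \<psi> y) = norm y *\<^sub>R sgn y"
    using assms(2)[OF sgn_in_sphere[OF False]]
    by (simp add: radial_extension_def[of \<phi>] norm_radial_extension[OF assms(1)])
  then show ?thesis using False by (simp add: sgn_div_norm)
qed (simp add: radial_extension_def)

text \<open>Projecting to the unit sphere is Lipschitz away from the origin: replacing \<open>b\<close> by its rescaling
to the length of \<open>a\<close> moves it by \<open>\<bar>\<parallel>b\<parallel> - \<parallel>a\<parallel>\<bar> \<le> \<parallel>a - b\<parallel>\<close>.\<close>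
lemma norm_mult_norm_sgn_diff_le:
  fixes a b :: "'a::real_normed_vector"
  shows "norm a * norm (sgn a - sgn b) \<le> 2 * norm (a - b)"
proof -
  have "norm a *\<^sub>R sgn a = a" "norm b *\<^sub>R sgn b = b"
    by (cases "a = 0"; cases "b = 0"; simp add: sgn_div_norm)+
  then have "norm a *\<^sub>R (sgn a - sgn b) = (a - b) + (norm b - norm a) *\<^sub>R sgn b"
    by (simp add: algebra_simps)
  then have "norm a * norm (sgn a - sgn b) = norm ((a - b) + (norm b - norm a) *\<^sub>R sgn b)"
    by (metis abs_norm_cancel norm_scaleR)
  also have "\<dots> \<le> norm (a - b) + \<bar>norm b - norm a\<bar> * norm (sgn b)"
    by (metis norm_scaleR norm_triangle_ineq)
  also have "\<dots> \<le> 2 * norm (a - b)"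
    using norm_triangle_ineq3[of b a] by (simp add: norm_sgn norm_minus_commute)
  finally show ?thesis .
qed

text \<open>Let \<open>a\<close> be the longer of the two vectors. If \<open>a\<close> and \<open>b\<close> are far apart compared with the
length of \<open>a\<close>, then the left-hand side, which is at most \<open>(2 \<parallel>a\<parallel>)\<^sup>p\<close>, is absorbed by the last term.
Otherwise their directions are close, and uniform continuity on the sphere bounds the left-hand side by
a small multiple of \<open>\<parallel>a\<parallel>\<^sup>p\<close>.\<close>
lemma radial_extension_powr_estimate:
  fixes \<phi> :: "'a::real_normed_vector \<Rightarrow> 'b::real_normed_vector"
  assumes uc: "uniformly_continuous_on (sphere 0 1) \<phi>"
    and maps: "\<phi> \<in> sphere 0 1 \<rightarrow> sphere 0 1"
    and p: "0 < p" and \<epsilon>: "0 < \<epsilon>"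
  shows "\<exists>C>0. \<forall>a b. norm (radial_extension \<phi> a - radial_extension \<phi> b) powr p
               \<le> \<epsilon> * (norm a powr p + norm b powr p) + C * norm (a - b) powr p"
proof -
  define \<eta> where "\<eta> = \<epsilon> powr (1 / p) / 2"
  have \<eta>: "0 < \<eta>" "(2 * \<eta>) powr p = \<epsilon>"
    using \<epsilon> p by (auto simp: \<eta>_def powr_powr)
  obtain d where d: "0 < d"
    "\<And>x y. x \<in> sphere 0 1 \<Longrightarrow> y \<in> sphere 0 1 \<Longrightarrow> dist x y < d \<Longrightarrow> dist (\<phi> x) (\<phi> y) < \<eta>"
    using uc \<eta>(1) unfolding uniformly_continuous_on_def by (metis dist_commute)
  \<comment> \<open>Here \<open>d / 2\<close> compensates the Lipschitz constant 2 of the projection to the sphere, \<open>\<eta>\<close> bounds the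
    change of length, and 1 keeps \<open>b\<close> away from the origin.\<close>
  define \<delta> where "\<delta> = min (min 1 \<eta>) (d / 2)"
  have \<delta>: "0 < \<delta>" "\<delta> \<le> 1" "\<delta> \<le> \<eta>" "2 * \<delta> \<le> d"
    using d \<eta> by (auto simp: \<delta>_def)
  define C where "C = (2 / \<delta>) powr p"
  let ?F = "radial_extension \<phi>"
  have wlog: "norm (?F a - ?F b) powr p \<le> \<epsilon> * norm a powr p + C * norm (a - b) powr p"
    if ab: "norm b \<le> norm a" for a b
  proof (cases "\<delta> * norm a \<le> norm (a - b)")
    case True
    have "norm (?F a - ?F b) \<le> 2 * norm a"
      using norm_triangle_ineq4[of "?F a" "?F b"] ab by (simp add: norm_radial_extension[OF maps])
    also have "\<dots> \<le> 2 / \<delta> * norm (a - b)"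
      using True \<delta>(1) by (simp add: field_simps)
    finally have "norm (?F a - ?F b) powr p \<le> C * norm (a - b) powr p"
      unfolding C_def powr_mult[symmetric] using p by (intro powr_mono2) auto
    then show ?thesis using \<epsilon> by (smt (verit) mult_nonneg_nonneg powr_ge_zero)
  next
    case False
    then have close: "norm (a - b) < \<delta> * norm a" by simp
    then have a: "0 < norm a"
      using \<delta>(1) by (smt (verit, best) mult_not_zero norm_ge_zero)
    have b: "b \<noteq> 0"
      using close \<delta>(2) a by auto
    have "norm a * norm (sgn a - sgn b) < norm a * (2 * \<delta>)"
      using norm_mult_norm_sgn_diff_le[of a b] close by argo
    then have "dist (sgn a) (sgn b) < d"
      using a \<delta>(4) by (simp add: dist_norm)
    then have \<phi>: "norm (\<phi> (sgn a) - \<phi> (sgn b)) < \<eta>"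
      using d(2)[of "sgn a" "sgn b"] a b by (simp add: dist_norm norm_sgn)
    have "\<phi> (sgn b) \<in> sphere 0 1"
      using maps b sgn_in_sphere by blast
    then have unit: "norm (\<phi> (sgn b)) = 1" by simp
    have "?F a - ?F b = norm a *\<^sub>R (\<phi> (sgn a) - \<phi> (sgn b)) + (norm a - norm b) *\<^sub>R \<phi> (sgn b)"
      by (simp add: radial_extension_def algebra_simps)
    then have "norm (?F a - ?F b)
        \<le> norm a * norm (\<phi> (sgn a) - \<phi> (sgn b)) + \<bar>norm a - norm b\<bar>"
      using norm_triangle_ineq[of "norm a *\<^sub>R (\<phi> (sgn a) - \<phi> (sgn b))"
          "(norm a - norm b) *\<^sub>R \<phi> (sgn b)"] unit by simp
    also have "\<dots> \<le> norm a * \<eta> + norm (a - b)"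
      using \<phi> norm_triangle_ineq3[of a b] by (intro add_mono mult_left_mono) auto
    also have "norm (a - b) \<le> \<eta> * norm a"
      using close \<delta>(3) a by (smt (verit) mult_right_mono)
    finally have "norm (?F a - ?F b) \<le> 2 * \<eta> * norm a" by simp
    then have "norm (?F a - ?F b) powr p \<le> (2 * \<eta> * norm a) powr p"
      using p by (intro powr_mono2) auto
    also have "\<dots> = \<epsilon> * norm a powr p"
      using \<eta>(2) by (simp add: powr_mult)
    also have "\<dots> \<le> \<epsilon> * norm a powr p + C * norm (a - b) powr p"
      by (simp add: C_def)
    finally show ?thesis .
  qed
  have "norm (?F a - ?F b) powr p
      \<le> \<epsilon> * (norm a powr p + norm b powr p) + C * norm (a - b) powr p" for a b
  proof (cases "norm b \<le> norm a")
    case True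
    have "0 \<le> \<epsilon> * norm b powr p" using \<epsilon> by simp
    with wlog[OF True] show ?thesis by (simp add: distrib_left)
  next
    case False
    have "0 \<le> \<epsilon> * norm a powr p" using \<epsilon> by simp
    with False wlog[of a b] show ?thesis by (simp add: distrib_left norm_minus_commute)
  qed
  moreover have "0 < C" using \<delta>(1) by (simp add: C_def)
  ultimately show ?thesis by blast
qed

section \<open>Spectral gaps as Poincare inequalities\<close>

definition dirichlet_energy ::
  "('v, 'e) pre_digraph \<Rightarrow> real \<Rightarrow> ('v \<Rightarrow> 'a::real_normed_vector) \<Rightarrow> real" where
  "dirichlet_energy G p f = (\<Sum>e\<in>arcs G. norm (f (head G e) - f (tail G e)) powr p)"

definition deviation ::
  "('v, 'e) pre_digraph \<Rightarrow> real \<Rightarrow> ('v \<Rightarrow> 'a::real_normed_vector) \<Rightarrow> real" where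
  "deviation G p f = (\<Sum>v\<in>verts G. norm (f v - vertex_mean G f) powr p)"

lemma dirichlet_energy_nonneg: "0 \<le> dirichlet_energy G p f"
  by (simp add: dirichlet_energy_def sum_nonneg)

lemma deviation_nonneg: "0 \<le> deviation G p f"
  by (simp add: deviation_def sum_nonneg)

lemma (in fin_digraph) sum_out_arcs:
  fixes h :: "'b \<Rightarrow> 'c::comm_monoid_add"
  shows "(\<Sum>v\<in>verts G. \<Sum>e\<in>out_arcs G v. h e) = (\<Sum>e\<in>arcs G. h e)"
proof -
  have "(\<Sum>v\<in>verts G. \<Sum>e\<in>{e \<in> arcs G. tail G e = v}. h e) = (\<Sum>e\<in>arcs G. h e)"
    by (intro sum.group) auto
  then show ?thesis by (simp add: out_arcs_def)
qed

lemma (in fin_digraph) sum_out_arcs_eq_dirichlet_energy: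
  "(\<Sum>v\<in>verts G. \<Sum>e\<in>out_arcs G v. norm (f (head G e) - f v) powr p) = dirichlet_energy G p f"
proof -
  have "(\<Sum>v\<in>verts G. \<Sum>e\<in>out_arcs G v. norm (f (head G e) - f v) powr p)
      = (\<Sum>v\<in>verts G. \<Sum>e\<in>out_arcs G v. norm (f (head G e) - f (tail G e)) powr p)"
    by (intro sum.cong) auto
  then show ?thesis by (simp only: sum_out_arcs dirichlet_energy_def)
qed

context finite_connected_graph
begin

lemma sum_arcs_tail_le:
  assumes "max_degree G \<le> \<Delta>" and "\<And>v. 0 \<le> (h v :: real)"
  shows "(\<Sum>e\<in>arcs G. h (tail G e)) \<le> real \<Delta> * (\<Sum>v\<in>verts G. h v)"
proof -
  have "(\<Sum>e\<in>arcs G. h (tail G e)) = (\<Sum>v\<in>verts G. \<Sum>e\<in>out_arcs G v. h (tail G e))"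
    by (simp only: sum_out_arcs)
  also have "\<dots> = (\<Sum>v\<in>verts G. real (out_degree G v) * h v)"
    by (intro sum.cong) (auto simp: out_degree_def)
  also have "\<dots> \<le> (\<Sum>v\<in>verts G. real \<Delta> * h v)"
  proof (intro sum_mono mult_right_mono assms(2))
    fix v assume "v \<in> verts G"
    then have "out_degree G v \<le> max_degree G"
      unfolding max_degree_def by (intro Max_ge) auto
    then show "real (out_degree G v) \<le> real \<Delta>" using assms(1) by simp
  qed
  finally show ?thesis by (simp add: sum_distrib_left)
qed

lemma sum_arcs_head_eq_tail: "(\<Sum>e\<in>arcs G. h (head G e)) = (\<Sum>e\<in>arcs G. h (tail G e))"
proof -
  obtain r where "\<forall>e\<in>arcs G. r e \<in> arcs G \<and> r (r e) = e
      \<and> tail G (r e) = head G e \<and> head G (r e) = tail G e"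
    using ex_reversal by blast
  then show ?thesis
    by (intro sum.reindex_bij_witness[where i = r and j = r]) auto
qed

lemma verts_nonempty: "verts G \<noteq> {}" and card_verts_pos: "0 < card (verts G)"
  using two_vertices by auto

lemma vertex_mean_diff_const: "vertex_mean G (\<lambda>v. f v - c) = vertex_mean G f - c"
  using card_verts_pos verts_nonempty
  by (simp add: vertex_mean_def sum_subtractf scaleR_right_diff_distrib)
     (simp add: scaleR_scaleR sum_constant_scaleR)

lemma norm_vertex_mean_powr_le:
  assumes "1 \<le> p"
  shows "real (card (verts G)) * norm (vertex_mean G f) powr p \<le> (\<Sum>v\<in>verts G. norm (f v) powr p)"
proof -
  have "norm (\<Sum>v\<in>verts G. (1 / real (card (verts G))) *\<^sub>R f v) powr p
      \<le> (\<Sum>v\<in>verts G. 1 / real (card (verts G)) * norm (f v) powr p)"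
    using verts_nonempty card_verts_pos
    by (intro convex_on_sum[OF _ _ convex_on_norm_powr[OF assms]]) auto
  then have "norm (vertex_mean G f) powr p
      \<le> 1 / real (card (verts G)) * (\<Sum>v\<in>verts G. norm (f v) powr p)"
    by (simp add: vertex_mean_def scaleR_sum_right sum_distrib_left)
  then show ?thesis
    using card_verts_pos by (simp add: field_simps)
qed

text \<open>The function \<open>f - c\<close> has mean \<open>- c\<close>, so by Jensen's inequality its norm controls that of the constant
\<open>c\<close>, and thereby that of \<open>f = (f - c) + c\<close>.\<close>
lemma sum_norm_powr_le_distance_from_const:
  fixes f :: "'v \<Rightarrow> 'c::real_normed_vector"
  assumes p: "1 \<le> p" and mean: "vertex_mean G f = 0"
  shows "(\<Sum>v\<in>verts G. norm (f v) powr p)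
       \<le> 2 * 2 powr p * (\<Sum>v\<in>verts G. norm (f v - c) powr p)"
proof -
  let ?Q = "\<Sum>v\<in>verts G. norm (f v - c) powr p"
  have c: "real (card (verts G)) * norm c powr p \<le> ?Q"
    using norm_vertex_mean_powr_le[OF p, of "\<lambda>v. f v - c"] mean
    by (simp add: vertex_mean_diff_const)
  have "(\<Sum>v\<in>verts G. norm (f v) powr p)
      \<le> (\<Sum>v\<in>verts G. 2 powr p * (norm (f v - c) powr p + norm c powr p))"
    using norm_add_powr_le[of p "f _ - c" c] p by (intro sum_mono) simp
  also have "\<dots> = 2 powr p * (?Q + real (card (verts G)) * norm c powr p)"
    by (simp add: sum_distrib_left[symmetric] sum.distrib)
  also have "\<dots> \<le> 2 powr p * (?Q + ?Q)"
    using c by (intro mult_left_mono) auto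
  finally show ?thesis by simp
qed

lemma deviation_pos:
  assumes "\<not> f constant_on verts G"
  shows "0 < deviation G p f"
proof -
  obtain v where "v \<in> verts G" "f v \<noteq> vertex_mean G f"
    using assms unfolding constant_on_def by blast
  then show ?thesis
    unfolding deviation_def by (intro sum_pos2[of _ v]) auto
qed

lemma ex_nonconstant:
  assumes "\<exists>x :: 'c::real_normed_vector. x \<noteq> 0"
  shows "\<exists>f :: 'v \<Rightarrow> 'c. \<not> f constant_on verts G"
proof -
  obtain x :: 'c where x: "x \<noteq> 0" using assms by blast
  obtain u v where uv: "u \<in> verts G" "v \<in> verts G" "u \<noteq> v"
    using two_vertices by (metis One_nat_def Suc_1 card_le_Suc0_iff_eq finite_verts not_less_eq_eq)
  have "\<not> (\<lambda>w. if w = u then x else 0) constant_on verts G"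
    using x uv unfolding constant_on_def by (metis (full_types))
  then show ?thesis by blast
qed

text \<open>Constant functions, over which the infimum does not range, satisfy the inequality trivially: both of
its sides involve only differences. Since the infimum is taken over a nonempty set of nonnegative
reals, the equivalence is also valid for negative \<open>\<kappa>\<close>.\<close>
lemma le_spectral_gap_iff:
  assumes "\<exists>x :: 'c::banach. x \<noteq> 0"
  shows "\<kappa> \<le> spectral_gap G TYPE('c) p \<longleftrightarrow>
    (\<forall>f :: 'v \<Rightarrow> 'c. 2 * \<kappa> * deviation G p f \<le> dirichlet_energy G p f)"
    (is "_ \<longleftrightarrow> ?poincare")
proof -
  let ?N = "{f :: 'v \<Rightarrow> 'c. \<not> f constant_on verts G}"
  let ?R = "\<lambda>f :: 'v \<Rightarrow> 'c. dirichlet_energy G p f / deviation G p f"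
  have gap: "spectral_gap G TYPE('c) p = 1 / 2 * (INF f\<in>?N. ?R f)"
    by (simp add: spectral_gap_def sum_out_arcs_eq_dirichlet_energy deviation_def)
  have "2 * \<kappa> \<le> (INF f\<in>?N. ?R f) \<longleftrightarrow> (\<forall>f\<in>?N. 2 * \<kappa> \<le> ?R f)"
  proof (rule le_cINF_iff)
    show "?N \<noteq> {}" using ex_nonconstant[OF assms] by blast
    show "bdd_below (?R ` ?N)"
      by (intro bdd_belowI2[of _ 0]) (simp add: dirichlet_energy_nonneg deviation_nonneg)
  qed
  also have "\<dots> \<longleftrightarrow> (\<forall>f\<in>?N. 2 * \<kappa> * deviation G p f \<le> dirichlet_energy G p f)"
    by (intro ball_cong refl) (simp add: pos_le_divide_eq deviation_pos)
  also have "\<dots> \<longleftrightarrow> ?poincare"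
  proof -
    have "2 * \<kappa> * deviation G p f \<le> dirichlet_energy G p f"
      if "f constant_on verts G" for f :: "'v \<Rightarrow> 'c"
    proof -
      obtain c where c: "\<And>v. v \<in> verts G \<Longrightarrow> f v = c"
        using \<open>f constant_on verts G\<close> unfolding constant_on_def by blast
      then have "vertex_mean G f = c"
        using card_verts_pos verts_nonempty by (simp add: vertex_mean_def sum_constant_scaleR)
      then have "deviation G p f = 0" by (simp add: deviation_def c)
      then show ?thesis by (simp add: dirichlet_energy_nonneg)
    qed
    then show ?thesis by blast
  qed
  finally show ?thesis unfolding gap by (simp add: mult.commute[of \<kappa>])
qed

end

text \<open>The first two conjuncts do not mention the Banach space, so comparing two spaces reduces to comparing
uniform Poincare inequalities.\<close>
lemma anders_family_iff_poincare:
  fixes G :: "nat \<Rightarrow> ('v, 'e) pre_digraph"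
  assumes nz: "\<exists>x :: 'a::banach. x \<noteq> 0" and G: "\<And>n. finite_connected_graph (G n)"
  shows "anders_family G TYPE('a) p \<longleftrightarrow>
     bdd_above (range (\<lambda>n. max_degree (G n))) \<and>
     (\<lambda>n. graph_diam (G n)) \<longlonglongrightarrow> \<infinity> \<and>
     (\<exists>\<kappa>>0. \<forall>n. \<forall>f :: 'v \<Rightarrow> 'a. 2 * \<kappa> * deviation (G n) p f \<le> dirichlet_energy (G n) p f)"
proof -
  note gap_iff = finite_connected_graph.le_spectral_gap_iff[OF G nz]
  have "0 \<le> spectral_gap (G n) TYPE('a) p" for n
    by (simp add: gap_iff dirichlet_energy_nonneg)
  then have bdd: "bdd_below (range (\<lambda>n. spectral_gap (G n) TYPE('a) p))"
    by (intro bdd_belowI2)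
  have "(INF n. spectral_gap (G n) TYPE('a) p) > 0 \<longleftrightarrow>
      (\<exists>\<kappa>>0. \<forall>n. \<kappa> \<le> spectral_gap (G n) TYPE('a) p)"
  proof
    assume "(INF n. spectral_gap (G n) TYPE('a) p) > 0"
    then show "\<exists>\<kappa>>0. \<forall>n. \<kappa> \<le> spectral_gap (G n) TYPE('a) p"
      using cINF_lower[OF bdd] by blast
  next
    assume "\<exists>\<kappa>>0. \<forall>n. \<kappa> \<le> spectral_gap (G n) TYPE('a) p"
    then obtain \<kappa> where "0 < \<kappa>" "\<And>n. \<kappa> \<le> spectral_gap (G n) TYPE('a) p" by blast
    then show "(INF n. spectral_gap (G n) TYPE('a) p) > 0"
      using cINF_greatest[of UNIV \<kappa> "\<lambda>n. spectral_gap (G n) TYPE('a) p"] by simp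
  qed
  then show ?thesis unfolding anders_family_def using G by (simp add: gap_iff)
qed

section \<open>Transfer of Poincare inequalities along sphere equivalences\<close>

text \<open>The coefficients in the two hypotheses on \<open>\<Phi>\<close> and \<open>\<Psi>\<close> are tuned for absorption. With
\<open>K = 2 \<cdot> 2\<^sup>p\<close>, the constant of \<open>sum_norm_powr_le_distance_from_const\<close>, the coefficient for \<open>\<Phi>\<close> is
\<open>1 / (4 K)\<close>, which leaves \<open>S \<le> S / 2 + \<dots>\<close>; the coefficient for \<open>\<Psi>\<close> is \<open>c / (4 K C' (\<Delta> + 1))\<close>,
which leaves \<open>c S \<le> c S / 2 + \<dots>\<close>, where \<open>\<Delta> + 1\<close> avoids a division by zero.\<close>
lemma (in finite_connected_graph) poincare_transfer_fixed_constants: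
  fixes \<Phi> :: "'c::real_normed_vector \<Rightarrow> 'd::real_normed_vector" and \<Psi> :: "'d \<Rightarrow> 'c"
  assumes p: "1 \<le> p" and c: "0 < c" and \<Delta>: "max_degree G \<le> \<Delta>"
    and C: "0 < C" "0 < C'"
    and norm: "\<And>y. norm (\<Psi> y) = norm y" and inverse: "\<And>y. \<Phi> (\<Psi> y) = y"
    and \<Phi>: "\<And>a b. norm (\<Phi> a - \<Phi> b) powr p
         \<le> 1 / (8 * 2 powr p) * (norm a powr p + norm b powr p) + C' * norm (a - b) powr p"
    and \<Psi>: "\<And>a b. norm (\<Psi> a - \<Psi> b) powr p
         \<le> c / (8 * 2 powr p * C' * (\<Delta> + 1)) * (norm a powr p + norm b powr p)
           + C * norm (a - b) powr p"
    and poincare: "\<And>g :: 'v \<Rightarrow> 'c. 2 * c * deviation G p g \<le> dirichlet_energy G p g"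
  shows "c / (4 * 2 powr p * C' * C) * deviation G p (f :: 'v \<Rightarrow> 'd) \<le> dirichlet_energy G p f"
proof -
  define h where "h v = f v - vertex_mean G f" for v
  define g where "g v = \<Psi> (h v)" for v
  define S where "S = (\<Sum>v\<in>verts G. norm (h v) powr p)"
  define E where "E = dirichlet_energy G p f"
  define \<epsilon> where "\<epsilon> = c / (8 * 2 powr p * C' * (\<Delta> + 1))"
  define K :: real where "K = 2 * 2 powr p"
  have K: "0 < K" by (simp add: K_def)
  have S: "0 \<le> S" by (simp add: S_def sum_nonneg)
  have \<epsilon>: "0 \<le> \<epsilon>" using c C by (simp add: \<epsilon>_def)
  have mean_h: "vertex_mean G h = 0"
    using vertex_mean_diff_const[of f "vertex_mean G f"] by (simp add: h_def[abs_def])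
  \<comment> \<open>The energy of \<open>h\<close> is that of \<open>f\<close>, because subtracting the mean does not change differences.\<close>
  have "dirichlet_energy G p g
      \<le> (\<Sum>e\<in>arcs G. \<epsilon> * (norm (h (head G e)) powr p + norm (h (tail G e)) powr p)
                    + C * norm (f (head G e) - f (tail G e)) powr p)"
    unfolding dirichlet_energy_def g_def \<epsilon>_def
    using \<Psi>[of "h (head G _)" "h (tail G _)"] by (intro sum_mono) (simp add: h_def)
  also have "\<dots> = \<epsilon> * (2 * (\<Sum>e\<in>arcs G. norm (h (tail G e)) powr p)) + C * E"
    by (simp add: sum.distrib sum_distrib_left[symmetric] E_def dirichlet_energy_def
        sum_arcs_head_eq_tail[of "\<lambda>v. norm (h v) powr p"])
  also have "\<dots> \<le> \<epsilon> * (2 * (\<Delta> * S)) + C * E"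
    unfolding S_def using \<Delta> \<epsilon>
    by (intro add_right_mono mult_left_mono sum_arcs_tail_le) auto
  finally have energy_g: "dirichlet_energy G p g \<le> \<epsilon> * (2 * (\<Delta> * S)) + C * E" .
  define m where "m = vertex_mean G g"
  have m: "real (card (verts G)) * norm m powr p \<le> S"
    using norm_vertex_mean_powr_le[OF p, of g] by (simp add: m_def S_def g_def norm)
  have "(\<Sum>v\<in>verts G. norm (h v - \<Phi> m) powr p)
      \<le> (\<Sum>v\<in>verts G. 1 / (4 * K) * (norm (h v) powr p + norm m powr p)
                     + C' * norm (g v - m) powr p)"
    using \<Phi>[of "g _" m] by (intro sum_mono) (simp add: g_def inverse norm K_def)
  also have "\<dots> = 1 / (4 * K) * (S + real (card (verts G)) * norm m powr p) + C' * deviation G p g"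
    by (simp add: sum.distrib sum_distrib_left[symmetric] sum_divide_distrib[symmetric]
        S_def deviation_def m_def)
  also have "\<dots> \<le> 1 / (4 * K) * (S + S) + C' * deviation G p g"
    using m K by (intro add_right_mono mult_left_mono add_left_mono) auto
  finally have distance: "(\<Sum>v\<in>verts G. norm (h v - \<Phi> m) powr p)
      \<le> 1 / (4 * K) * (S + S) + C' * deviation G p g" .
  have "S \<le> K * (\<Sum>v\<in>verts G. norm (h v - \<Phi> m) powr p)"
    unfolding S_def K_def by (rule sum_norm_powr_le_distance_from_const[OF p mean_h])
  also have "\<dots> \<le> K * (1 / (4 * K) * (S + S) + C' * deviation G p g)"
    using distance K by (intro mult_left_mono) auto
  also have "\<dots> = S / 2 + K * C' * deviation G p g"
    using K by (simp add: field_simps)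
  finally have "S \<le> 2 * (K * C' * deviation G p g)" by simp
  then have "c * S \<le> K * C' * (2 * c * deviation G p g)"
    using c mult_left_mono[of S _ c] by (simp add: mult_ac)
  also have "\<dots> \<le> K * C' * (\<epsilon> * (2 * (\<Delta> * S)) + C * E)"
    using order_trans[OF poincare energy_g] K C by (intro mult_left_mono) auto
  also have "\<dots> = (c / 2 * S) * (\<Delta> / (\<Delta> + 1)) + K * C' * C * E"
    using C by (simp add: \<epsilon>_def K_def divide_simps) (simp add: algebra_simps)
  also have "\<dots> \<le> c / 2 * S * 1 + K * C' * C * E"
    using c S by (intro add_right_mono mult_left_mono) auto
  finally have "c * S \<le> 2 * (K * C' * C) * E" by simp
  then have "c / (2 * (K * C' * C)) * S \<le> E"
    using K C by (simp add: field_simps)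
  then show ?thesis
    by (simp add: K_def S_def h_def deviation_def E_def mult_ac)
qed

text \<open>A function is moved from the second space to the first by \<open>\<psi>\<close> and back by \<open>\<phi>\<close>. The constant \<open>C'\<close>
for \<open>\<phi>\<close> is chosen before the constant \<open>C\<close> for \<open>\<psi>\<close>, because it enters the precision demanded of \<open>\<psi>\<close>.\<close>
lemma anders_family_transfer:
  fixes G :: "nat \<Rightarrow> ('v, 'e) pre_digraph"
    and \<phi> :: "'a::banach \<Rightarrow> 'b::banach" and \<psi> :: "'b \<Rightarrow> 'a"
  assumes nz: "\<exists>x :: 'a. x \<noteq> 0" "\<exists>y :: 'b. y \<noteq> 0"
    and \<phi>: "uniformly_continuous_on (sphere 0 1) \<phi>" "\<phi> \<in> sphere 0 1 \<rightarrow> sphere 0 1"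
    and \<psi>: "uniformly_continuous_on (sphere 0 1) \<psi>" "\<psi> \<in> sphere 0 1 \<rightarrow> sphere 0 1"
    and inverse: "\<And>y. y \<in> sphere 0 1 \<Longrightarrow> \<phi> (\<psi> y) = y"
    and p: "1 \<le> p" and G: "\<And>n. finite_connected_graph (G n)"
    and anders: "anders_family G TYPE('a) p"
  shows "anders_family G TYPE('b) p"
proof -
  note anders' = anders[unfolded anders_family_iff_poincare[OF nz(1) G]]
  obtain \<Delta> where \<Delta>: "\<And>n. max_degree (G n) \<le> \<Delta>"
    using anders' by (auto simp: bdd_above_def)
  obtain c where c: "0 < c"
    "\<And>n (g :: 'v \<Rightarrow> 'a). 2 * c * deviation (G n) p g \<le> dirichlet_energy (G n) p g"
    using anders' by blast
  have p_pos: "0 < p" using p by simp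
  obtain C' where C': "0 < C'"
    "\<forall>a b. norm (radial_extension \<phi> a - radial_extension \<phi> b) powr p
         \<le> 1 / (8 * 2 powr p) * (norm a powr p + norm b powr p) + C' * norm (a - b) powr p"
    using radial_extension_powr_estimate[OF \<phi> p_pos, of "1 / (8 * 2 powr p)"] by auto
  have \<epsilon>_pos: "0 < c / (8 * 2 powr p * C' * (\<Delta> + 1))" using c(1) C'(1) by simp
  obtain C where C: "0 < C"
    "\<forall>a b. norm (radial_extension \<psi> a - radial_extension \<psi> b) powr p
         \<le> c / (8 * 2 powr p * C' * (\<Delta> + 1)) * (norm a powr p + norm b powr p)
           + C * norm (a - b) powr p"
    using radial_extension_powr_estimate[OF \<psi> p_pos \<epsilon>_pos] by blast
  define \<kappa> where "\<kappa> = c / (8 * 2 powr p * C' * C)"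
  have \<kappa>: "2 * \<kappa> = c / (4 * 2 powr p * C' * C)" by (simp add: \<kappa>_def)
  have poincare: "2 * \<kappa> * deviation (G n) p f \<le> dirichlet_energy (G n) p f" for n and f :: "'v \<Rightarrow> 'b"
    unfolding \<kappa>
    by (rule finite_connected_graph.poincare_transfer_fixed_constants[OF G p c(1) \<Delta> C(1) C'(1)
        norm_radial_extension[OF \<psi>(2)] radial_extension_inverse[OF \<psi>(2) inverse] C'(2)[rule_format]
        C(2)[rule_format] c(2)])
  have \<kappa>_pos: "0 < \<kappa>" using c(1) C(1) C'(1) by (simp add: \<kappa>_def)
  show ?thesis
    unfolding anders_family_iff_poincare[OF nz(2) G]
  proof (intro conjI)
    show "\<exists>\<kappa>>0. \<forall>n. \<forall>f :: 'v \<Rightarrow> 'b. 2 * \<kappa> * deviation (G n) p f \<le> dirichlet_energy (G n) p f"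
      by (rule exI[of _ \<kappa>]) (simp only: \<kappa>_pos poincare simp_thms)
  qed (use anders' in simp_all)
qed

theorem theoremA:
  fixes G :: "nat \<Rightarrow> ('v, 'e) pre_digraph" and p :: real
  assumes "\<exists>x :: 'a::banach. x \<noteq> 0" and "\<exists>y :: 'b::banach. y \<noteq> 0"
    and "sphere_equivalent TYPE('a) TYPE('b)"
    and "1 \<le> p"
    and "\<And>n. finite_connected_graph (G n)"
  shows "anders_family G TYPE('a) p \<longleftrightarrow> anders_family G TYPE('b) p"
proof -
  obtain \<phi> :: "'a \<Rightarrow> 'b" where bij: "bij_betw \<phi> (sphere 0 1) (sphere 0 1)"
    and uc: "uniformly_continuous_on (sphere 0 1) \<phi>"
      "uniformly_continuous_on (sphere 0 1) (inv_into (sphere 0 1) \<phi>)"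
    using assms(3) unfolding sphere_equivalent_def by blast
  let ?\<psi> = "inv_into (sphere 0 1) \<phi>"
  have maps: "\<phi> \<in> sphere 0 1 \<rightarrow> sphere 0 1" "?\<psi> \<in> sphere 0 1 \<rightarrow> sphere 0 1"
    using bij_betw_imp_funcset[OF bij] bij_betw_imp_funcset[OF bij_betw_inv_into[OF bij]] .
  show ?thesis
  proof
    assume "anders_family G TYPE('a) p"
    then show "anders_family G TYPE('b) p"
      using assms(4,5)
      by (intro anders_family_transfer[OF assms(1,2) uc(1) maps(1) uc(2) maps(2)]
          bij_betw_inv_into_right[OF bij])
  next
    assume "anders_family G TYPE('b) p"
    then show "anders_family G TYPE('a) p"
      using assms(4,5)
      by (intro anders_family_transfer[OF assms(2,1) uc(2) maps(2) uc(1) maps(1)]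
          bij_betw_inv_into_left[OF bij])
  qed
qed

end
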